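(* Let $P$ be a cycle of a convergent pattern $\pi$ such that the $P$-linear map $f$ has over-rotation interval $I_f=[\rho(P),\frac12]$ (i.e. $r_\pi=\rho(\pi)$), and suppose the over-rotation pair of $P$ is coprime. Then $\pi$ is an over-twist pattern.
   Context: A cyclic pattern is the equivalence class of a cyclic permutation realized by a periodic orbit $P$ on the line; the $P$-linear map is the map on $[\min P,\max P]$ agreeing with the cycle on $P$ and affine between consecutive points of $P$. A pattern $A$ forces $B$ if every continuous interval map with a cycle of pattern $A$ has a cycle of pattern $B$. Over-rotation pair: for a cycle $P$ of period $q\ge 2$ of $f$, $2p$ is the number of $x\in P$ with $f(x)-x$ and $f^2(x)-f(x)$ of different signs; $orp(P)=(p,q)$, $\rho(P)=p/q$. The over-rotation interval $I_f$ of a map is the closure of the set of over-rotation numbers of its non-fixed periodic orbits, of the form $[r_f,\frac12]$; for a pattern $\pi$ with representative $P$, $r_\pi$ is $r_{f}$ for the $P$-linear map $f$. A cycle is convergent if there are no points $x<y$ in it with $f(x)<x$ and $f(y)>y$. An over-twist pattern is a pattern minimal with respect to forcing among patterns of the same over-rotation number. *)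

theory Defs
  imports "HOL-Analysis.Analysis"
begin

definition is_cycle :: "(real \<Rightarrow> real) \<Rightarrow> real set \<Rightarrow> bool" where
  "is_cycle f P \<longleftrightarrow> finite P \<and> P \<noteq> {} \<and> f ` P \<subseteq> P \<and>
     (\<forall>x\<in>P. \<forall>y\<in>P. \<exists>n. (f ^^ n) x = y)"

text \<open>Patterns are represented by the cyclic permutation of positions {0..<q}:
  the i-th entry is the position (in increasing order of P) of the image of the i-th point.\<close>
definition pattern_of :: "(real \<Rightarrow> real) \<Rightarrow> real set \<Rightarrow> nat list" where
  "pattern_of f P = map (\<lambda>x. card {y\<in>P. y < f x}) (sorted_list_of_set P)"

definition cyclic_pattern :: "nat list \<Rightarrow> bool" where
  "cyclic_pattern \<theta> \<longleftrightarrow> (\<exists>f P. is_cycle f P \<and> pattern_of f P = \<theta>)"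

definition sign_changes :: "(real \<Rightarrow> real) \<Rightarrow> real set \<Rightarrow> nat" where
  "sign_changes f P = card {x\<in>P. (f x - x) * (f (f x) - f x) < 0}"

definition orp :: "(real \<Rightarrow> real) \<Rightarrow> real set \<Rightarrow> nat \<times> nat" where
  "orp f P = (sign_changes f P div 2, card P)"

definition rho :: "(real \<Rightarrow> real) \<Rightarrow> real set \<Rightarrow> real" where
  "rho f P = real (fst (orp f P)) / real (snd (orp f P))"

definition canon_set :: "nat list \<Rightarrow> real set" where
  "canon_set \<theta> = real ` {0..<length \<theta>}"

definition canon_map :: "nat list \<Rightarrow> real \<Rightarrow> real" where
  "canon_map \<theta> = (\<lambda>x. real (\<theta> ! nat \<lfloor>x\<rfloor>))"

definition rho_pat :: "nat list \<Rightarrow> real" where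
  "rho_pat \<theta> = rho (canon_map \<theta>) (canon_set \<theta>)"

definition convergent_cycle :: "(real \<Rightarrow> real) \<Rightarrow> real set \<Rightarrow> bool" where
  "convergent_cycle f P \<longleftrightarrow> \<not> (\<exists>x\<in>P. \<exists>y\<in>P. x < y \<and> f x < x \<and> f y > y)"

definition P_linear :: "(real \<Rightarrow> real) \<Rightarrow> real set \<Rightarrow> real \<Rightarrow> real" where
  "P_linear f P x =
     (if x \<le> Min P then f (Min P)
      else if Max P \<le> x then f (Max P)
      else (let a = Max {p\<in>P. p \<le> x}; b = Min {p\<in>P. x < p}
            in f a + (f b - f a) * (x - a) / (b - a)))"

definition interval_map :: "(real \<Rightarrow> real) \<Rightarrow> real \<Rightarrow> real \<Rightarrow> bool" where
  "interval_map f a b \<longleftrightarrow> a \<le> b \<and> continuous_on {a..b} f \<and> f ` {a..b} \<subseteq> {a..b}"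

definition has_cycle_of_pattern :: "(real \<Rightarrow> real) \<Rightarrow> real \<Rightarrow> real \<Rightarrow> nat list \<Rightarrow> bool" where
  "has_cycle_of_pattern f a b \<theta> \<longleftrightarrow> (\<exists>Q. Q \<subseteq> {a..b} \<and> is_cycle f Q \<and> pattern_of f Q = \<theta>)"

definition forces :: "nat list \<Rightarrow> nat list \<Rightarrow> bool" where
  "forces A B \<longleftrightarrow> (\<forall>f a b. interval_map f a b \<and> has_cycle_of_pattern f a b A
                      \<longrightarrow> has_cycle_of_pattern f a b B)"

definition orot_interval :: "(real \<Rightarrow> real) \<Rightarrow> real \<Rightarrow> real \<Rightarrow> real set" where
  "orot_interval f a b =
     closure {rho f Q | Q. Q \<subseteq> {a..b} \<and> is_cycle f Q \<and> card Q \<ge> 2}"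

definition over_twist :: "nat list \<Rightarrow> bool" where
  "over_twist \<pi> \<longleftrightarrow> cyclic_pattern \<pi> \<and>
     (\<forall>\<theta>. cyclic_pattern \<theta> \<and> length \<theta> \<ge> 2 \<and> rho_pat \<theta> = rho_pat \<pi> \<and> forces \<pi> \<theta>
           \<longrightarrow> \<theta> = \<pi>)"

end

theory Submission
  imports Defs
begin

text \<open>
  Let \<open>f\<close> be the \<open>P\<close>-linear map and \<open>a\<close> its only fixed point; an over-rotation number is half the
  frequency with which an orbit crosses \<open>a\<close>. If an orbit segment from \<open>y\<close> ends on the side of \<open>y\<close>, at
  least as far from \<open>a\<close>, the intermediate value theorem gives a periodic point with the same crossings,
  so the crossing frequency of the segment is at least \<open>2 * rho f P\<close> by minimality of \<open>rho f P\<close>. Hence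
  the code, the function on \<open>P\<close> that increases by \<open>crossing / 2 - rho f P\<close> along \<open>f\<close>, increases
  with the distance from \<open>a\<close> on each side, strictly so because the over-rotation pair is coprime. Given
  another cycle \<open>Q\<close> with the same over-rotation number, send each of its points to the nearest point of
  \<open>P\<close> away from \<open>a\<close>. Strict monotonicity of the code forces this map to commute with \<open>f\<close>. It is
  injective: \<open>f\<close> is affine between neighbours in \<open>P\<close>, so the distance of two points of \<open>Q\<close> in one fibre
  from their common image differs by a factor that is a positive root of unity, that is, \<open>1\<close>. So \<open>Q\<close> and \<open>P\<close> have
  the same pattern.
\<close>

section \<open>Cycles\<close>

lemma is_cycle_funpow_closed:
  assumes "is_cycle f Q" "x \<in> Q"
  shows "(f ^^ n) x \<in> Q"
  using assms by (induction n) (auto simp: is_cycle_def)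

text \<open>The least return time \<open>n\<close> of \<open>x\<close> makes the first
  \<open>n\<close> iterates distinct, and every later iterate reduces modulo \<open>n\<close>. Since
  the orbit of \<open>x\<close> is all of \<open>Q\<close>, this \<open>n\<close> is
  \<open>card Q\<close>.\<close>

lemma is_cycle_orbit:
  assumes "is_cycle f Q" "x \<in> Q"
  shows "(f ^^ card Q) x = x" "bij_betw (\<lambda>i. (f ^^ i) x) {..<card Q} Q"
proof -
  define n where "n = (LEAST n. 0 < n \<and> (f ^^ n) x = x)"
  obtain k where "(f ^^ k) (f x) = x"
    using assms unfolding is_cycle_def by blast
  then have ex: "\<exists>n. 0 < n \<and> (f ^^ n) x = x"
    by (intro exI[of _ "Suc k"]) (simp add: funpow_swap1)
  have n: "0 < n" "(f ^^ n) x = x"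
    using LeastI_ex[OF ex] by (auto simp: n_def)
  have least: "(f ^^ m) x \<noteq> x" if "0 < m" "m < n" for m
    using not_less_Least[of m "\<lambda>n. 0 < n \<and> (f ^^ n) x = x"] that by (auto simp: n_def)
  have ne: "(f ^^ i) x \<noteq> (f ^^ j) x" if "i < j" "j < n" for i j
  proof
    assume eq: "(f ^^ i) x = (f ^^ j) x"
    have "(f ^^ (n - j + i)) x = (f ^^ (n - j)) ((f ^^ j) x)"
      by (simp add: funpow_add eq)
    also have "\<dots> = (f ^^ (n - j + j)) x"
      by (simp only: funpow_add o_apply)
    also have "\<dots> = x" using n that by simp
    finally have "(f ^^ (n - j + i)) x = x" .
    moreover have "0 < n - j + i" "n - j + i < n" using that by linarith+
    ultimately show False by (metis least)
  qed
  have inj: "inj_on (\<lambda>i. (f ^^ i) x) {..<n}"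
  proof (rule inj_onI)
    fix i j assume "i \<in> {..<n}" "j \<in> {..<n}" "(f ^^ i) x = (f ^^ j) x"
    then show "i = j" using ne[of i j] ne[of j i] by (cases i j rule: linorder_cases) auto
  qed
  have img: "(\<lambda>i. (f ^^ i) x) ` {..<n} = Q"
  proof (rule equalityI)
    show "(\<lambda>i. (f ^^ i) x) ` {..<n} \<subseteq> Q"
      by (rule image_subsetI) (rule is_cycle_funpow_closed[OF assms])
    show "Q \<subseteq> (\<lambda>i. (f ^^ i) x) ` {..<n}"
    proof (rule subsetI)
      fix y assume y: "y \<in> Q"
      obtain k where k: "(f ^^ k) x = y"
        using assms(1,2) y unfolding is_cycle_def by metis
      have "(f ^^ (k mod n)) x = y"
        using funpow_mod_eq[OF n(2), of k] k by (rule trans)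
      then show "y \<in> (\<lambda>i. (f ^^ i) x) ` {..<n}"
        using n(1) by (intro image_eqI[of _ _ "k mod n"]) simp_all
    qed
  qed
  have "card Q = n" using card_image[OF inj] img by simp
  then show "(f ^^ card Q) x = x" "bij_betw (\<lambda>i. (f ^^ i) x) {..<card Q} Q"
    using n inj img by (auto simp: bij_betw_def)
qed

lemma is_cycle_bij:
  assumes "is_cycle f Q"
  shows "bij_betw f Q Q"
proof -
  have "Q \<subseteq> f ` Q"
  proof
    fix y assume y: "y \<in> Q"
    have "card Q \<noteq> 0" using assms by (auto simp: is_cycle_def)
    then obtain k where "card Q = Suc k" by (cases "card Q") auto
    then have "f ((f ^^ k) y) = y" using is_cycle_orbit(1)[OF assms y] by simp
    then show "y \<in> f ` Q" using is_cycle_funpow_closed[OF assms y] by (metis imageI)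
  qed
  then have "f ` Q = Q" using assms by (auto simp: is_cycle_def)
  then show ?thesis
    using assms eq_card_imp_inj_on[of Q f] by (auto simp: is_cycle_def bij_betw_def)
qed

lemma sum_funpow_periodic:
  fixes h :: "'a \<Rightarrow> real"
  assumes "(f ^^ m) x = x"
  shows "(\<Sum>i<k * m. h ((f ^^ i) x)) = real k * (\<Sum>i<m. h ((f ^^ i) x))"
proof (induction k)
  case (Suc k)
  have "(f ^^ (i + k * m)) x = (f ^^ i) x" for i
    using funpow_mod_eq[OF assms, of "i + k * m"] funpow_mod_eq[OF assms, of i] by simp
  then have "(\<Sum>i<m. h ((f ^^ (i + k * m)) x)) = (\<Sum>i<m. h ((f ^^ i) x))" by simp
  moreover have "(\<Sum>i<Suc k * m. h ((f ^^ i) x))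
      = (\<Sum>i<k * m. h ((f ^^ i) x)) + (\<Sum>i<m. h ((f ^^ (i + k * m)) x))"
    using sum.shift_bounds_nat_ivl[of "\<lambda>i. h ((f ^^ i) x)" 0 "k * m" m]
      sum.atLeastLessThan_concat[of 0 "k * m" "m + k * m" "\<lambda>i. h ((f ^^ i) x)"]
    by (simp add: lessThan_atLeast0)
  ultimately show ?case by (simp add: Suc algebra_simps)
qed simp

text \<open>A return time is a multiple of \<open>card Q\<close>, so the average of \<open>h\<close>
  along a closed orbit segment is its average over \<open>Q\<close>, however often the segment runs
  around the cycle.\<close>

lemma sum_orbit_is_cycle:
  fixes h :: "real \<Rightarrow> real"
  assumes Q: "is_cycle f Q" "x \<in> Q" and n: "(f ^^ n) x = x"
  shows "card Q * (\<Sum>i<n. h ((f ^^ i) x)) = n * (\<Sum>y\<in>Q. h y)"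
proof -
  let ?q = "card Q"
  note orb = is_cycle_orbit[OF Q]
  have "?q > 0" using Q by (auto simp: is_cycle_def card_gt_0_iff)
  have "(f ^^ (n mod ?q)) x = (f ^^ 0) x" using funpow_mod_eq[OF orb(1)] n by simp
  then have "n mod ?q = 0"
    using bij_betw_imp_inj_on[OF orb(2)] \<open>?q > 0\<close>
    by (meson inj_on_def lessThan_iff mod_less_divisor)
  then obtain k where k: "n = k * ?q" by (metis mod_0_imp_dvd dvd_def mult.commute)
  have "(\<Sum>i<?q. h ((f ^^ i) x)) = (\<Sum>y\<in>Q. h y)"
    using sum.reindex_bij_betw[OF orb(2), of h] by simp
  then show ?thesis using sum_funpow_periodic[OF orb(1), of h k] by (simp add: k)
qed

lemma is_cycle_of_periodic:
  assumes "(f ^^ n) x = x" "0 < n"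
  shows "is_cycle f ((\<lambda>i. (f ^^ i) x) ` {..<n})" (is "is_cycle f ?Q")
proof -
  have mem: "(f ^^ k) x \<in> ?Q" for k
    using funpow_mod_eq[OF assms(1), of k] assms(2)
    by (intro image_eqI[of _ _ "k mod n"]) auto
  have "\<exists>k. (f ^^ k) ((f ^^ i) x) = (f ^^ j) x" if "i < n" for i j
  proof
    have "(f ^^ (j + (n - i))) ((f ^^ i) x) = (f ^^ (j + (n - i) + i)) x"
      by (simp only: funpow_add o_apply)
    also have "\<dots> = (f ^^ j) ((f ^^ n) x)" 
    proof -
      have "j + (n - i) + i = j + n" using that by simp
      then show ?thesis by (simp only: funpow_add o_apply)
    qed
    finally show "(f ^^ (j + (n - i))) ((f ^^ i) x) = (f ^^ j) x" by (simp add: assms)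
  qed
  moreover have "f ((f ^^ i) x) \<in> ?Q" for i using mem[of "Suc i"] by simp
  ultimately show ?thesis unfolding is_cycle_def using assms(2) by auto
qed

lemma is_cycle_no_fixpoint:
  assumes "is_cycle f Q" "2 \<le> card Q" "x \<in> Q"
  shows "f x \<noteq> x"
proof
  assume fx: "f x = x"
  have "(f ^^ n) x = x" for n by (induction n) (auto simp: fx)
  then have "Q \<subseteq> {x}" using assms unfolding is_cycle_def by (metis singletonI subsetI)
  then show False using assms(2) card_mono[of "{x}" Q] by simp
qed

section \<open>Order-preserving conjugacies\<close>

lemma sorted_list_of_set_strict_mono_image:
  fixes h :: "'a::linorder \<Rightarrow> 'b::linorder"
  assumes "finite Q" "strict_mono_on Q h"
  shows "sorted_list_of_set (h ` Q) = map h (sorted_list_of_set Q)"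
proof -
  have "sorted_wrt (<) (map h (sorted_list_of_set Q))"
    unfolding sorted_wrt_map
    using assms by (intro sorted_wrt_mono_rel[OF _ strict_sorted_list_of_set])
      (auto simp: strict_mono_on_def)
  then show ?thesis
    using assms by (intro strict_sorted_equal) auto
qed

text \<open>An order-preserving conjugacy preserves ranks, and a pattern records only ranks of
  images. This is how two cycles will be shown to have one pattern.\<close>

lemma pattern_of_conjugate:
  assumes "finite Q" "strict_mono_on Q h" "f ` Q \<subseteq> Q" "\<And>x. x \<in> Q \<Longrightarrow> f' (h x) = h (f x)"
  shows "pattern_of f' (h ` Q) = pattern_of f Q"
proof -
  have "card {y \<in> h ` Q. y < f' (h x)} = card {y \<in> Q. y < f x}" if "x \<in> Q" for x
  proof -
    have "{y \<in> h ` Q. y < f' (h x)} = h ` {y \<in> Q. y < f x}"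
      using assms(3) that strict_mono_on_less[OF assms(2)] by (auto simp: assms(4) image_subset_iff)
    moreover have "inj_on h {y \<in> Q. y < f x}"
      using strict_mono_on_imp_inj_on[OF assms(2)] by (rule inj_on_subset) auto
    ultimately show ?thesis by (simp add: card_image)
  qed
  then show ?thesis
    using assms by (simp add: pattern_of_def sorted_list_of_set_strict_mono_image)
qed

lemma rho_conjugate:
  assumes "finite Q" "strict_mono_on Q h" "f ` Q \<subseteq> Q" "\<And>x. x \<in> Q \<Longrightarrow> f' (h x) = h (f x)"
  shows "rho f' (h ` Q) = rho f Q"
proof -
  have inj: "inj_on h Q" using strict_mono_on_imp_inj_on[OF assms(2)] .
  have iff: "(h a - h b) * (h c - h a) < 0 \<longleftrightarrow> (a - b) * (c - a) < 0" if "a \<in> Q" "b \<in> Q" "c \<in> Q" for a b c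
    using strict_mono_on_less[OF assms(2)] that by (auto simp: mult_less_0_iff)
  have "{x \<in> h ` Q. (f' x - x) * (f' (f' x) - f' x) < 0}
      = h ` {x \<in> Q. (f x - x) * (f (f x) - f x) < 0}"
    using assms iff by (force simp: image_subset_iff)
  moreover have "inj_on h {x \<in> Q. (f x - x) * (f (f x) - f x) < 0}"
    using inj by (rule inj_on_subset) auto
  ultimately show ?thesis
    using inj by (simp add: rho_def orp_def sign_changes_def card_image)
qed

lemma sorted_list_of_set_nth_rank:
  fixes Q :: "'a::linorder set"
  assumes "finite Q" "x \<in> Q"
  shows "sorted_list_of_set Q ! card {y \<in> Q. y < x} = x"
proof -
  define xs where "xs = sorted_list_of_set Q"
  have xs: "sorted_wrt (<) xs" "set xs = Q" using assms by (auto simp: xs_def)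
  then obtain i where i: "i < length xs" "xs ! i = x" using assms by (metis in_set_conv_nth)
  have less: "xs ! j < xs ! k \<longleftrightarrow> j < k" if "j < length xs" "k < length xs" for j k
    using xs(1) that by (metis linorder_neqE_nat order_less_asym' sorted_wrt_nth_less)
  have "{y \<in> Q. y < x} = (!) xs ` {..<i}"
  proof (intro set_eqI iffI)
    fix y assume "y \<in> {y \<in> Q. y < x}"
    then obtain j where "j < length xs" "y = xs ! j" "xs ! j < xs ! i"
      using xs(2) i by (auto simp: in_set_conv_nth)
    then show "y \<in> (!) xs ` {..<i}" using less i by auto
  next
    fix y assume "y \<in> (!) xs ` {..<i}"
    then obtain j where "j < i" "y = xs ! j" by auto
    then show "y \<in> {y \<in> Q. y < x}" using less[of j i] i xs(2) by (auto intro: nth_mem)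
  qed
  moreover have "inj_on ((!) xs) {..<i}"
    using i by (intro inj_on_nth) (auto simp: xs_def)
  ultimately have "card {y \<in> Q. y < x} = i" by (simp add: card_image)
  then show ?thesis using i by (simp add: xs_def)
qed

text \<open>Ranking the points of \<open>Q\<close> is an order-preserving conjugacy onto the
  canonical representative, and \<open>rho\<close> depends only on the order. Thus
  \<open>rho_pat\<close> can be computed on any cycle with the given pattern.\<close>

lemma rho_pat_pattern_of:
  assumes "finite Q" "f ` Q \<subseteq> Q"
  shows "rho_pat (pattern_of f Q) = rho f Q"
proof -
  define rank where "rank x = card {y \<in> Q. y < x}" for x
  have rank_less: "rank x < rank y" if "x \<in> Q" "y \<in> Q" "x < y" for x y
    unfolding rank_def using that assms by (intro psubset_card_mono) auto
  have rank_lt: "rank x < card Q" if "x \<in> Q" for x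
    unfolding rank_def using that assms by (intro psubset_card_mono) auto
  have mono: "strict_mono_on Q (\<lambda>x. real (rank x))"
    using rank_less by (auto simp: strict_mono_on_def)
  have "rank ` Q = {0..<card Q}"
  proof (rule card_subset_eq)
    have "inj_on rank Q" using rank_less by (metis inj_onI linorder_neqE order_less_irrefl)
    then show "card (rank ` Q) = card {0..<card Q}" by (simp add: card_image)
  qed (use rank_lt in auto)
  then have "canon_set (pattern_of f Q) = (\<lambda>x. real (rank x)) ` Q"
    by (simp add: canon_set_def pattern_of_def flip: image_image)
  moreover have "canon_map (pattern_of f Q) (real (rank x)) = real (rank (f x))" if "x \<in> Q" for x
    using rank_lt[OF that] sorted_list_of_set_nth_rank[OF assms(1) that]
    by (simp add: canon_map_def pattern_of_def rank_def)
  ultimately show ?thesis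
    using rho_conjugate[OF assms(1) mono assms(2)] by (simp add: rho_pat_def)
qed

section \<open>Periodic points with a prescribed itinerary\<close>

lemma funpow_closed_on:
  assumes "f ` I \<subseteq> I" "x \<in> I"
  shows "(f ^^ n) x \<in> I"
  using assms by (induction n) auto

lemma continuous_on_funpow:
  fixes f :: "'a::topological_space \<Rightarrow> 'a"
  assumes "continuous_on I f" "f ` I \<subseteq> I"
  shows "continuous_on I (f ^^ n)"
proof (induction n)
  case (Suc n)
  have "(f ^^ n) ` I \<subseteq> I" using funpow_closed_on[OF assms(2)] by blast
  then have "continuous_on I (f \<circ> f ^^ n)"
    using Suc assms by (intro continuous_on_compose) (auto intro: continuous_on_subset)
  then show ?case by simp
qed (simp add: id_def)

text \<open>Slide the starting point from \<open>a\<close> to \<open>y\<close> and look beyond the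
  last position whose \<open>n\<close>-th iterate is \<open>a\<close>: there all iterates up to
  \<open>n\<close> keep the sides of those of \<open>y\<close>. If that position is not
  \<open>a\<close>, the intermediate value theorem yields the periodic point. If it is
  \<open>a\<close>, starting points arbitrarily close to \<open>a\<close> share the itinerary of
  \<open>y\<close>, and near \<open>a\<close> sides alternate. The quotient in \<open>out\<close>
  says at once that the segment ends on the side of \<open>y\<close> and not closer to
  \<open>a\<close>.\<close>

lemma periodic_point_same_sides:
  fixes f :: "real \<Rightarrow> real"
  assumes cont: "continuous_on {A..B} f" and maps: "f ` {A..B} \<subseteq> {A..B}"
    and fa: "f a = a" and aI: "a \<in> {A..B}" and y: "y \<in> {A..B}" "y \<noteq> a"
    and "l < a" "a < r"
    and flip: "\<And>x. x \<in> {l<..<r} \<Longrightarrow> x \<noteq> a \<Longrightarrow> (f x < a) \<noteq> (x < a)"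
    and out: "1 \<le> ((f ^^ n) y - a) / (y - a)"
  shows "(\<exists>z\<in>{A..B}. z \<noteq> a \<and> (f ^^ n) z = z \<and> (\<forall>i\<le>n. ((f ^^ i) z < a) = ((f ^^ i) y < a)))
     \<or> (\<forall>i<n. ((f ^^ Suc i) y < a) \<noteq> ((f ^^ i) y < a))"
proof -
  define \<gamma> where "\<gamma> t = a + t * (y - a)" for t
  define F where "F i t = (f ^^ i) (\<gamma> t)" for i t
  have \<gamma>_mem: "\<gamma> t \<in> {A..B}" if "t \<in> {0..1}" for t
  proof -
    have "\<gamma> t = (1 - t) *\<^sub>R a + t *\<^sub>R y" by (simp add: \<gamma>_def algebra_simps)
    then show ?thesis
      using that aI y convexD_alt[OF convex_real_interval(5)[of A B], of a y t] by simp
  qed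
  have contF: "continuous_on {0..1} (F i)" for i
  proof -
    have "continuous_on {0..1} \<gamma>" unfolding \<gamma>_def by (intro continuous_intros)
    moreover have "\<gamma> ` {0..1} \<subseteq> {A..B}" using \<gamma>_mem by blast
    ultimately show ?thesis
      unfolding F_def
      by (rule continuous_on_compose2[OF continuous_on_funpow[OF cont maps]])
  qed
  have fna: "(f ^^ i) a = a" for i by (induction i) (auto simp: fa)
  have F0: "F i 0 = a" for i by (simp add: F_def \<gamma>_def fna)
  have F1: "F i 1 = (f ^^ i) y" for i by (simp add: F_def \<gamma>_def)
  have "F n 1 \<noteq> a" using out by (auto simp: F1)
  \<comment> \<open>The last parameter at which the \<open>n\<close>-th iterate hits
    \<open>a\<close> is the maximum \<open>c\<close> of the compact set \<open>Z\<close>.\<close>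
  define Z where "Z = {0..1} \<inter> F n -` {a}"
  have "closed Z" unfolding Z_def by (intro continuous_closed_preimage contF) auto
  then have "compact Z" unfolding Z_def
    by (metis bounded_Int bounded_closed_interval compact_eq_bounded_closed)
  moreover have "0 \<in> Z" by (simp add: Z_def F0)
  ultimately obtain c where c: "c \<in> Z" "\<And>t. t \<in> Z \<Longrightarrow> t \<le> c"
    using compact_attains_sup[of Z] by blast
  have c01: "0 \<le> c" "c < 1" "F n c = a"
    using c(1) \<open>F n 1 \<noteq> a\<close> by (auto simp: Z_def less_le)
  \<comment> \<open>An orbit that reaches the fixed point \<open>a\<close> stays there, so an
    earlier hit would put \<open>t\<close> into \<open>Z\<close> beyond its maximum.\<close>
  have not_a: "F i t \<noteq> a" if "c < t" "t \<le> 1" "i \<le> n" for i t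
  proof
    assume "F i t = a"
    moreover have "F n t = (f ^^ (n - i)) (F i t)"
      using that by (simp add: F_def flip: funpow_add comp_apply[of "f ^^ (n - i)" "f ^^ i"])
    ultimately have "t \<in> Z" using that c01 by (simp add: Z_def fna)
    then show False using c(2) that by force
  qed
  have same: "(F i t < a) = (F i 1 < a)" if t: "c < t" "t \<le> 1" "i \<le> n" for i t
  proof (rule ccontr)
    assume ne: "(F i t < a) \<noteq> (F i 1 < a)"
    have ct: "continuous_on {t..1} (F i)"
      using contF[of i] by (rule continuous_on_subset) (use t c01 in auto)
    have "\<exists>x. t \<le> x \<and> x \<le> 1 \<and> F i x = a"
    proof (cases "F i t < a")
      case True
      then show ?thesis using ne t by (intro IVT' ct) auto
    next
      case False
      then show ?thesis using ne t by (intro IVT2' ct) auto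
    qed
    then obtain x where "t \<le> x" "x \<le> 1" "F i x = a" by blast
    then show False using not_a[of x i] t by simp
  qed
  show ?thesis
  proof (cases "c = 0")
    case False
    \<comment> \<open>The zeros of \<open>k\<close> are the parameters of fixed points of the
      \<open>n\<close>-th iterate. At \<open>c\<close> the value is \<open>-c < 0\<close>, and at 1
      it is nonnegative by \<open>out\<close>, so there is a zero strictly beyond
      \<open>c\<close>.\<close>
    define k where "k t = (F n t - a) / (y - a) - t" for t
    have "continuous_on {c..1} (F n)"
      using contF[of n] by (rule continuous_on_subset) (use c01 in auto)
    then have "continuous_on {c..1} k"
      unfolding k_def using y by (intro continuous_intros) auto
    moreover have "k c \<le> 0" "0 \<le> k 1" using c01 out by (auto simp: k_def F1)
    ultimately obtain t where t: "c \<le> t" "t \<le> 1" "k t = 0"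
      using IVT'[of k c 0 1] c01 by auto
    have "k c \<noteq> 0" using c01 False by (simp add: k_def)
    then have "c < t" using t by (metis less_le)
    have "F n t - a = t * (y - a)" using t(3) y by (simp add: k_def field_simps)
    then have "(f ^^ n) (\<gamma> t) = \<gamma> t" by (simp add: F_def \<gamma>_def)
    moreover have "\<gamma> t \<noteq> a" using \<open>c < t\<close> c01 y by (simp add: \<gamma>_def)
    moreover have "\<forall>i\<le>n. ((f ^^ i) (\<gamma> t) < a) = ((f ^^ i) y < a)"
      using same[OF \<open>c < t\<close> t(2)] by (simp add: F1) (simp add: F_def)
    ultimately show ?thesis using \<gamma>_mem[of t] t c01 by auto
  next
    \<comment> \<open>As \<open>t\<close> tends to 0, all of the finitely many iterates tend to
      \<open>a\<close> and enter \<open>{l<..<r}\<close>, where \<open>flip\<close> applies.\<close>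
    case True
    have "\<forall>\<^sub>F t in at_right 0. F i t \<in> {l<..<r}" for i
    proof -
      have "(F i \<longlongrightarrow> F i 0) (at 0 within {0..1})"
        using contF[of i] by (simp add: continuous_on)
      then have "(F i \<longlongrightarrow> a) (at_right 0)" by (simp add: F0 at_within_Icc_at_right)
      then show ?thesis using \<open>l < a\<close> \<open>a < r\<close> 
        by (auto dest: order_tendstoD intro: eventually_conj)
    qed
    then have "\<forall>\<^sub>F t in at_right 0. \<forall>i\<in>{..n}. F i t \<in> {l<..<r}"
      by (intro eventually_ball_finite) auto
    moreover have "\<forall>\<^sub>F t in at_right (0::real). 0 < t \<and> t < 1"
      by (auto simp: eventually_at_right[of 0 1] intro: exI[of _ 1])
    ultimately have "\<forall>\<^sub>F t in at_right 0. (\<forall>i\<in>{..n}. F i t \<in> {l<..<r}) \<and> 0 < t \<and> t < 1"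
      by (rule eventually_conj)
    then obtain t where t: "\<And>i. i \<le> n \<Longrightarrow> F i t \<in> {l<..<r}" "0 < t" "t < 1"
      using eventually_happens'[OF trivial_limit_at_right_real[of 0]] by blast
    have "((f ^^ Suc i) y < a) \<noteq> ((f ^^ i) y < a)" if "i < n" for i
    proof -
      have "(F (Suc i) t < a) \<noteq> (F i t < a)"
        using flip[OF t(1)[of i] not_a[of t i]] that t True by (simp add: F_def)
      then show ?thesis using same[of t i] same[of t "Suc i"] that t True by (simp add: F1)
    qed
    then show ?thesis by blast
  qed
qed

section \<open>Piecewise affine maps\<close>

lemma consecutive_around:
  fixes P :: "real set"
  assumes "finite P" "P \<noteq> {}" "x \<in> {Min P..Max P}" "Min P < Max P"
  obtains p p' where "p \<in> P" "p' \<in> P" "p < p'" "P \<inter> {p<..<p'} = {}" "x \<in> {p..p'}"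
proof (cases "x < Max P")
  case True
  define L R where "L = {p \<in> P. p \<le> x}" "R = {p \<in> P. x < p}"
  have LR: "finite L" "finite R" "Min P \<in> L" "Max P \<in> R"
    using assms True by (auto simp: L_R_def)
  then have in_LR: "Max L \<in> L" "Min R \<in> R" by (metis Max_in Min_in empty_iff)+
  have "z \<le> Max L \<or> Min R \<le> z" if "z \<in> P" for z
  proof (cases "z \<le> x")
    case True
    then show ?thesis using that LR(1) by (intro disjI1 Max_ge) (auto simp: L_R_def)
  next
    case False
    then show ?thesis using that LR(2) by (intro disjI2 Min_le) (auto simp: L_R_def)
  qed
  then have "P \<inter> {Max L<..<Min R} = {}" by fastforce
  then show thesis using that[of "Max L" "Min R"] in_LR by (simp add: L_R_def)
next
  case False
  then have x: "x = Max P" using assms by auto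
  define L where "L = {p \<in> P. p < x}"
  have L: "finite L" "Min P \<in> L"
    using assms x by (auto simp: L_def)
  then have "Max L \<in> L" by (metis Max_in empty_iff)
  moreover have "z \<le> Max L" if "z \<in> P" "z < x" for z
    using that L(1) by (intro Max_ge) (auto simp: L_def)
  then have "P \<inter> {Max L<..<x} = {}" by fastforce
  ultimately show thesis using that[of "Max L" x] assms x by (simp add: L_def)
qed

lemma P_linear_mem:
  assumes "finite P" "p \<in> P"
  shows "P_linear g P p = g p"
proof -
  have "Min P \<le> p" "p \<le> Max P" using assms by auto
  moreover have "Max {q \<in> P. q \<le> p} = p" using assms by (intro Max_eqI) auto
  ultimately show ?thesis by (auto simp: P_linear_def Let_def)
qed

lemma P_linear_affine:
  assumes "finite P" "p \<in> P" "p' \<in> P" "p < p'" "P \<inter> {p<..<p'} = {}" "x \<in> {p..p'}"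
  shows "P_linear g P x = g p + (g p' - g p) * (x - p) / (p' - p)"
proof (cases "x = p \<or> x = p'")
  \<comment> \<open>At \<open>p'\<close> the definition of \<open>P_linear\<close> selects the next
    gap or the constant extension, so the ends are evaluated as points of \<open>P\<close>.\<close>
  case True
  then show ?thesis using assms P_linear_mem[OF assms(1)] by auto
next
  case False
  then have x: "p < x" "x < p'" using assms by auto
  have gap: "q \<le> p \<or> p' \<le> q" if "q \<in> P" for q
  proof (rule ccontr)
    assume "\<not> (q \<le> p \<or> p' \<le> q)"
    then have "q \<in> P \<inter> {p<..<p'}" using that by simp
    then show False unfolding assms(5) by simp
  qed
  have "Min P \<le> p" "p' \<le> Max P" using assms by auto
  moreover have "Max {q \<in> P. q \<le> x} = p"
  proof (intro Max_eqI)
    fix q assume "q \<in> {q \<in> P. q \<le> x}"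
    then show "q \<le> p" using gap[of q] x by auto
  qed (use assms x in auto)
  moreover have "Min {q \<in> P. x < q} = p'"
  proof (intro Min_eqI)
    fix q assume "q \<in> {q \<in> P. x < q}"
    then show "p' \<le> q" using gap[of q] x by auto
  qed (use assms x in auto)
  ultimately show ?thesis using x by (simp add: P_linear_def Let_def)
qed

lemma affine_between:
  fixes u v :: real
  assumes "p < p'" "x \<in> {p..p'}"
  shows "min u v \<le> u + (v - u) * (x - p) / (p' - p)" "u + (v - u) * (x - p) / (p' - p) \<le> max u v"
proof -
  define t where "t = (x - p) / (p' - p)"
  have t: "0 \<le> t" "t \<le> 1" using assms by (auto simp: t_def)
  have "u + (v - u) * t \<in> closed_segment u v"
    unfolding closed_segment_def using t by (auto simp: algebra_simps intro!: exI[of _ t])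
  then have "min u v \<le> u + (v - u) * t" "u + (v - u) * t \<le> max u v"
    by (auto simp: closed_segment_eq_real_ivl split: if_splits)
  then show "min u v \<le> u + (v - u) * (x - p) / (p' - p)" "u + (v - u) * (x - p) / (p' - p) \<le> max u v"
    by (simp_all add: t_def)
qed

section \<open>Convergent cycles of least over-rotation number\<close>

text \<open>The geometry of the \<open>P\<close>-linear map of a convergent cycle: \<open>l\<close>
  and \<open>r\<close> are the points of \<open>P\<close> adjacent to the fixed point
  \<open>a\<close>, convergence has become \<open>right\<close> and \<open>left\<close>, and
  \<open>min_rho\<close> says that \<open>rho f P\<close> is the left end of the over-rotation
  interval.\<close>

locale minimal_cycle =
  fixes f :: "real \<Rightarrow> real" and P :: "real set" and l a r :: real
  assumes cyc: "is_cycle f P"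
    and l: "l \<in> P" "l < a" and r: "r \<in> P" "a < r" and gap: "P \<inter> {l<..<r} = {}"
    and fa: "f a = a"
    and right: "\<And>x. x \<in> {Min P..Max P} \<Longrightarrow> x < a \<Longrightarrow> x < f x"
    and left: "\<And>x. x \<in> {Min P..Max P} \<Longrightarrow> a < x \<Longrightarrow> f x < x"
    and affine: "\<And>p p' x. p \<in> P \<Longrightarrow> p' \<in> P \<Longrightarrow> p < p' \<Longrightarrow> P \<inter> {p<..<p'} = {} \<Longrightarrow> x \<in> {p..p'}
      \<Longrightarrow> f x = f p + (f p' - f p) * (x - p) / (p' - p)"
    and min_rho: "\<And>Q. Q \<subseteq> {Min P..Max P} \<Longrightarrow> is_cycle f Q \<Longrightarrow> 2 \<le> card Q \<Longrightarrow> rho f P \<le> rho f Q"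
    and cop: "coprime (fst (orp f P)) (snd (orp f P))"
begin

lemma finite_P: "finite P" and P_nonempty: "P \<noteq> {}"
  using cyc by (auto simp: is_cycle_def)

lemma f_mem: "p \<in> P \<Longrightarrow> f p \<in> P"
  using cyc by (auto simp: is_cycle_def)

lemma P_gap: "p \<le> l \<or> r \<le> p" if "p \<in> P"
proof (rule ccontr)
  assume "\<not> (p \<le> l \<or> r \<le> p)"
  then have "p \<in> P \<inter> {l<..<r}" using that by simp
  then show False unfolding gap by simp
qed

lemma P_le: "p \<in> P \<Longrightarrow> Min P \<le> p" "p \<in> P \<Longrightarrow> p \<le> Max P"
  using finite_P by auto

lemma P_ne_a: "p \<in> P \<Longrightarrow> p \<noteq> a"
  using P_gap l r by force

lemma Min_less_Max: "Min P < Max P" and a_mem: "a \<in> {Min P..Max P}"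
  using P_le[OF l(1)] P_le[OF r(1)] l r by auto

lemma card_P: "2 \<le> card P"
proof -
  have "card {l, r} \<le> card P" using finite_P l r by (intro card_mono) auto
  then show ?thesis using l r by simp
qed

text \<open>The point \<open>l\<close> moves right and \<open>r\<close> moves left, and
  \<open>P\<close> has no point between them. So \<open>f l\<close> is at least \<open>r\<close> and
  \<open>f r\<close> at most \<open>l\<close>, and the affine piece through \<open>a\<close> is
  decreasing.\<close>

lemma middle: "\<exists>s<0. \<forall>x\<in>{l..r}. f x = a + s * (x - a)"
proof (intro exI conjI ballI)
  define s where "s = (f r - f l) / (r - l)"
  have "l < f l" "f r < r" using l r P_le by (auto intro: right left)
  then have "r \<le> f l" "f r \<le> l" using P_gap f_mem l r by (metis not_le)+
  then show "s < 0" using l r unfolding s_def by (intro divide_neg_pos) auto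
  fix x assume x: "x \<in> {l..r}"
  have "f z = f l + s * (z - l)" if "z \<in> {l..r}" for z
    using affine[OF l(1) r(1) _ gap that] l r by (simp add: s_def)
  from this[OF x] this[of a] show "f x = a + s * (x - a)"
    using l r by (simp add: fa algebra_simps)
qed

lemma flip:
  assumes "x \<in> {l<..<r}" "x \<noteq> a"
  shows "(f x < a) \<noteq> (x < a)"
  using middle assms by (auto simp: mult_less_0_iff)

lemma continuous_f: "continuous_on {Min P..Max P} f"
proof -
  define G where "G = {(p, p'). p \<in> P \<and> p' \<in> P \<and> p < p' \<and> P \<inter> {p<..<p'} = {}}"
  have "G \<subseteq> P \<times> P" by (auto simp: G_def)
  then have "finite G" using finite_P by (rule finite_subset[OF _ finite_cartesian_product]) (rule finite_P)
  moreover have "continuous_on {fst g..snd g} f" if "g \<in> G" for g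
  proof -
    obtain p p' where g: "g = (p, p')" by (cases g)
    have "continuous_on {p..p'} (\<lambda>x. f p + (f p' - f p) * (x - p) / (p' - p))"
      using that g by (intro continuous_intros) (auto simp: G_def)
    moreover have "continuous_on {p..p'} f
        = continuous_on {p..p'} (\<lambda>x. f p + (f p' - f p) * (x - p) / (p' - p))"
      using that g affine by (intro continuous_on_cong) (auto simp: G_def)
    ultimately show ?thesis using g by simp
  qed
  ultimately have "continuous_on (\<Union>g\<in>G. {fst g..snd g}) f"
    by (intro continuous_on_closed_Union) auto
  moreover have "{Min P..Max P} \<subseteq> (\<Union>g\<in>G. {fst g..snd g})"
  proof
    fix x assume "x \<in> {Min P..Max P}"
    then obtain p p' where "p \<in> P" "p' \<in> P" "p < p'" "P \<inter> {p<..<p'} = {}" "x \<in> {p..p'}"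
      using consecutive_around[OF finite_P P_nonempty _ Min_less_Max] by metis
    then show "x \<in> (\<Union>g\<in>G. {fst g..snd g})" by (force simp: G_def)
  qed
  ultimately show ?thesis by (rule continuous_on_subset)
qed

lemma f_maps: "f ` {Min P..Max P} \<subseteq> {Min P..Max P}"
proof (rule image_subsetI)
  fix x assume "x \<in> {Min P..Max P}"
  then obtain p p' where p: "p \<in> P" "p' \<in> P" "p < p'" "P \<inter> {p<..<p'} = {}" "x \<in> {p..p'}"
    using consecutive_around[OF finite_P P_nonempty _ Min_less_Max] by metis
  have "min (f p) (f p') \<le> f x" "f x \<le> max (f p) (f p')"
    using affine[OF p] affine_between[OF p(3,5), where u="f p" and v="f p'"] by simp_all
  then show "f x \<in> {Min P..Max P}"
    using P_le[OF f_mem[OF p(1)]] P_le[OF f_mem[OF p(2)]] by (auto simp: min_def max_def split: if_splits)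
qed

section \<open>Over-rotation numbers as crossing frequencies of the fixed point\<close>

definition crossing :: "real \<Rightarrow> nat" where
  "crossing x = of_bool ((x < a) \<noteq> (f x < a))"

lemma even_crossings:
  "even (\<Sum>i<n. crossing ((f ^^ i) x)) \<longleftrightarrow> (x < a) = ((f ^^ n) x < a)"
  by (induction n) (auto simp: crossing_def)

lemma cycle_ne_a:
  assumes "is_cycle f Q" "2 \<le> card Q" "x \<in> Q"
  shows "x \<noteq> a"
  using is_cycle_no_fixpoint[OF assms] fa by auto

text \<open>Points move right exactly when they lie left of \<open>a\<close>, so the displacement
  changes sign at \<open>x\<close> exactly when the step from \<open>x\<close> crosses
  \<open>a\<close>. As \<open>f\<close> permutes \<open>Q\<close>, crossings in the two directions
  are equally many; hence the total is even and the \<open>div 2\<close> in \<open>orp\<close> loses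
  nothing.\<close>

lemma crossings_eq_orp:
  assumes Q: "Q \<subseteq> {Min P..Max P}" "is_cycle f Q" "2 \<le> card Q"
  shows "(\<Sum>x\<in>Q. crossing x) = 2 * fst (orp f Q)"
    and "rho f Q = real (\<Sum>x\<in>Q. crossing x) / (2 * card Q)"
proof -
  have fin: "finite Q" using Q by (auto simp: is_cycle_def)
  have fQ: "f x \<in> Q" if "x \<in> Q" for x using Q that by (auto simp: is_cycle_def)
  let ?A = "{x \<in> Q. x < a}" and ?B = "{x \<in> Q. f x < a}"
  have bij: "bij_betw f Q Q" using is_cycle_bij[OF Q(2)] .
  have "f ` ?B = ?A"
    using bij by (auto simp: bij_betw_def)
  moreover have "inj_on f ?B"
    using bij by (auto simp: bij_betw_def intro: inj_on_subset)
  ultimately have "card ?A = card ?B" by (metis card_image)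
  then have "card (?A - ?B) = card (?B - ?A)"
    using fin by (simp add: card_Diff_subset_Int Int_commute)
  moreover have sgn: "(f x - x < 0) = (a < x)" "(0 < f x - x) = (x < a)" if "x \<in> Q" for x
    using right[of x] left[of x] cycle_ne_a[OF Q(2,3) that] that Q(1) by force+
  have "{x \<in> Q. (f x - x) * (f (f x) - f x) < 0} = (?A - ?B) \<union> (?B - ?A)"
    using sgn sgn[OF fQ] cycle_ne_a[OF Q(2,3)] fQ by (fastforce simp: mult_less_0_iff)
  moreover have "card ((?A - ?B) \<union> (?B - ?A)) = card (?A - ?B) + card (?B - ?A)"
    using fin by (intro card_Un_disjoint) auto
  ultimately have "sign_changes f Q = 2 * card (?A - ?B)"
    by (simp add: sign_changes_def)
  moreover have "(\<Sum>x\<in>Q. crossing x) = card ((?A - ?B) \<union> (?B - ?A))"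
  proof -
    have "(\<Sum>x\<in>Q. crossing x) = card {x \<in> Q. (x < a) \<noteq> (f x < a)}"
      using fin by (simp add: crossing_def Int_def)
    also have "{x \<in> Q. (x < a) \<noteq> (f x < a)} = (?A - ?B) \<union> (?B - ?A)" by auto
    finally show ?thesis .
  qed
  ultimately show *: "(\<Sum>x\<in>Q. crossing x) = 2 * fst (orp f Q)"
    using \<open>card (?A - ?B) = card (?B - ?A)\<close> \<open>card ((?A - ?B) \<union> (?B - ?A)) = _\<close>
    by (simp add: orp_def)
  show "rho f Q = real (\<Sum>x\<in>Q. crossing x) / (2 * card Q)"
    unfolding * by (simp add: rho_def orp_def)
qed

lemma P_subset: "P \<subseteq> {Min P..Max P}"
  using P_le by auto

lemmas crossings_P = crossings_eq_orp[OF P_subset cyc card_P]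

lemma rho_le_half: "rho f P \<le> 1 / 2"
proof -
  have "(\<Sum>x\<in>P. crossing x) \<le> (\<Sum>x\<in>P. 1)" by (rule sum_mono) (simp add: crossing_def)
  then have "real (\<Sum>x\<in>P. crossing x) \<le> card P" by (simp del: of_nat_sum)
  then show ?thesis unfolding crossings_P(2) using card_P by (simp add: field_simps)
qed

text \<open>An orbit segment that ends on its initial side and not closer to \<open>a\<close> shadows a periodic orbit,
  unless it crosses \<open>a\<close> at every step.\<close>
lemma crossings_lower_bound:
  assumes y: "y \<in> {Min P..Max P}" "y \<noteq> a" and "0 < n"
    and out: "1 \<le> ((f ^^ n) y - a) / (y - a)"
  shows "real n * rho f P \<le> real (\<Sum>i<n. crossing ((f ^^ i) y)) / 2"
  using periodic_point_same_sides[OF continuous_f f_maps fa a_mem y l(2) r(2) _ out]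
proof (elim meta_impE disjE bexE conjE)
  show "(f x < a) \<noteq> (x < a)" if "x \<in> {l<..<r}" "x \<noteq> a" for x by (rule flip) fact+
next
  fix z assume z: "z \<in> {Min P..Max P}" "z \<noteq> a" "(f ^^ n) z = z"
    and same: "\<forall>i\<le>n. ((f ^^ i) z < a) = ((f ^^ i) y < a)"
  \<comment> \<open>Here \<open>n\<close> need not be the least period of \<open>z\<close>; passing
    to frequencies through \<open>sum_orbit_is_cycle\<close> makes this harmless.\<close>
  define Q where "Q = (\<lambda>i. (f ^^ i) z) ` {..<n}"
  have Q: "is_cycle f Q" unfolding Q_def by (rule is_cycle_of_periodic) fact+
  have zQ: "z \<in> Q" unfolding Q_def using \<open>0 < n\<close> by (intro image_eqI[of _ _ 0]) auto
  have "f z \<in> Q" using zQ Q by (auto simp: is_cycle_def)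
  moreover have "f z \<noteq> z" using right[OF z(1)] left[OF z(1)] z(2) by linarith
  ultimately have "card {z, f z} \<le> card Q"
    using zQ Q by (intro card_mono) (auto simp: is_cycle_def)
  then have Q2: "2 \<le> card Q" using \<open>f z \<noteq> z\<close> by simp
  have QI: "Q \<subseteq> {Min P..Max P}"
    unfolding Q_def by (intro image_subsetI funpow_closed_on[OF f_maps z(1)])
  have "(\<Sum>i<n. crossing ((f ^^ i) z)) = (\<Sum>i<n. crossing ((f ^^ i) y))"
  proof (rule sum.cong)
    fix i assume "i \<in> {..<n}"
    then show "crossing ((f ^^ i) z) = crossing ((f ^^ i) y)"
      using same[rule_format, of i] same[rule_format, of "Suc i"] by (simp add: crossing_def)
  qed simp
  then have "card Q * real (\<Sum>i<n. crossing ((f ^^ i) y)) = n * real (\<Sum>x\<in>Q. crossing x)"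
    using sum_orbit_is_cycle[OF Q zQ z(3), of "\<lambda>x. real (crossing x)"]
    by (simp flip: of_nat_sum)
  then have "rho f Q * real n = real (\<Sum>i<n. crossing ((f ^^ i) y)) / 2"
    unfolding crossings_eq_orp(2)[OF QI Q Q2] using Q2 by (simp add: field_simps flip: of_nat_sum)
  moreover have "rho f P * real n \<le> rho f Q * real n"
    using min_rho[OF QI Q Q2] by (rule mult_right_mono) simp
  ultimately show ?thesis by (simp add: mult.commute)
next
  \<comment> \<open>With a crossing at every step the bound reduces to
    \<open>rho_le_half\<close>.\<close>
  assume "\<forall>i<n. ((f ^^ Suc i) y < a) \<noteq> ((f ^^ i) y < a)"
  then have "(\<Sum>i<n. crossing ((f ^^ i) y)) = (\<Sum>i<n. 1)"
    by (intro sum.cong) (auto simp: crossing_def)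
  then have "(\<Sum>i<n. crossing ((f ^^ i) y)) = n" by simp
  then show ?thesis using mult_left_mono[OF rho_le_half, of "real n"] by (simp flip: of_nat_sum)
qed

section \<open>The code of the cycle\<close>

text \<open>The Birkhoff sums of \<open>crossing / 2 - rho f P\<close>, a function with mean zero
  over \<open>P\<close>.\<close>

definition excess :: "nat \<Rightarrow> real \<Rightarrow> real" where
  "excess n x = (\<Sum>i<n. real (crossing ((f ^^ i) x)) / 2 - rho f P)"

lemma excess_Suc: "excess (Suc n) x = excess 1 x + excess n (f x)"
  unfolding excess_def by (subst sum.lessThan_Suc_shift) (simp add: funpow_swap1)

lemma excess_eq: "excess n x = real (\<Sum>i<n. crossing ((f ^^ i) x)) / 2 - real n * rho f P"
  by (simp add: excess_def sum_subtractf sum_divide_distrib)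

lemma excess_card:
  assumes "x \<in> P"
  shows "excess (card P) x = 0"
proof -
  have "(\<Sum>i<card P. crossing ((f ^^ i) x)) = (\<Sum>x\<in>P. crossing x)"
    using sum.reindex_bij_betw[OF is_cycle_orbit(2)[OF cyc assms], of crossing] by simp
  then show ?thesis
    unfolding excess_eq crossings_P(2) using card_P by simp
qed

text \<open>Averaging the partial sums over one period yields a solution of the cohomological equation
  \<open>code (f x) = code x + crossing x / 2 - rho f P\<close> on \<open>P\<close> without choosing a base point.\<close>
definition code :: "real \<Rightarrow> real" where
  "code x = - (\<Sum>n<card P. excess n x) / card P"

lemma code_step:
  assumes "x \<in> P"
  shows "code (f x) = code x + real (crossing x) / 2 - rho f P"
proof -
  let ?q = "card P"
  have "excess n (f x) = excess (Suc n) x - excess 1 x" for n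
    using excess_Suc[of n x] by linarith
  then have "(\<Sum>n<?q. excess n (f x)) = (\<Sum>n<?q. excess (Suc n) x) - ?q * excess 1 x"
    by (simp add: sum_subtractf)
  \<comment> \<open>The shift trades the term at 0 for the term at \<open>?q\<close>; both vanish,
    the latter by \<open>excess_card\<close>.\<close>
  also have "(\<Sum>n<?q. excess (Suc n) x) = (\<Sum>n<?q. excess n x)"
    using sum.lessThan_Suc_shift[of "\<lambda>n. excess n x" ?q] excess_card[OF assms]
    by (simp add: excess_def)
  finally show ?thesis
    using card_P by (simp add: code_def excess_def field_simps)
qed

lemma code_funpow:
  assumes "x \<in> P"
  shows "code ((f ^^ n) x) = code x + excess n x"
proof (induction n)
  case (Suc n)
  then show ?case
    using code_step[OF is_cycle_funpow_closed[OF cyc assms, of n]] by (simp add: excess_def)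
qed (simp add: excess_def)

text \<open>The order by distance from \<open>a\<close>, taken on each side separately: points on
  opposite sides are incomparable, and \<open>a\<close> is related to nothing.\<close>

definition outward :: "real \<Rightarrow> real \<Rightarrow> bool" where
  "outward p x \<longleftrightarrow> (x < a \<and> p \<le> x) \<or> (a < x \<and> x \<le> p)"

lemma outward_same_side: "outward p x \<Longrightarrow> (p < a) = (x < a)"
  by (auto simp: outward_def)

text \<open>The orbit segment from \<open>y\<close> to \<open>x\<close> ends outward, so
  \<open>crossings_lower_bound\<close> makes its excess nonnegative, and the excess is the increase
  of the code. Both ends lie on one side, so the number of crossings is even, say
  \<open>2 * m\<close>. Zero excess would then give \<open>n * p = m * q\<close> for the
  over-rotation pair \<open>(p, q)\<close>; coprimality makes \<open>q\<close> divide
  \<open>n\<close>, whence \<open>x = y\<close>.\<close>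

lemma code_less:
  assumes xy: "x \<in> P" "y \<in> P" "x \<noteq> y" and out: "outward x y"
  shows "code y < code x"
proof -
  obtain n where n: "(f ^^ n) y = x" using cyc xy unfolding is_cycle_def by metis
  then have "0 < n" using xy by (cases n) auto
  let ?C = "\<Sum>i<n. crossing ((f ^^ i) y)" and ?p = "fst (orp f P)" and ?q = "card P"
  have "1 \<le> ((f ^^ n) y - a) / (y - a)"
    using out unfolding n outward_def by (auto simp: le_divide_eq)
  then have le: "real n * rho f P \<le> real ?C / 2"
    using crossings_lower_bound[OF _ P_ne_a \<open>0 < n\<close>] xy(2) P_le by simp
  have "real n * rho f P \<noteq> real ?C / 2"
  proof
    assume eq: "real n * rho f P = real ?C / 2"
    obtain m where m: "?C = 2 * m"
      using even_crossings[where n = n and x = y] outward_same_side[OF out] n by (auto elim: evenE)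
    have "real ?p = rho f P * ?q" using card_P by (simp add: rho_def orp_def)
    moreover have "real n * rho f P = real m" using eq m by simp
    ultimately have "real (n * ?p) = real (m * ?q)" by (simp flip: mult.assoc)
    then have "?q dvd n * ?p" by (metis dvd_triv_right of_nat_eq_iff)
    then have "?q dvd n"
      using cop by (simp add: orp_def coprime_commute coprime_dvd_mult_left_iff)
    then have "(f ^^ n) y = y"
      using funpow_mod_eq[OF is_cycle_orbit(1)[OF cyc xy(2)], of n] by simp
    then show False using n xy by simp
  qed
  then show ?thesis
    using le code_funpow[OF xy(2), of n] by (simp add: n excess_eq)
qed

section \<open>Outward neighbours\<close>

definition nbr :: "real \<Rightarrow> real" where
  "nbr x = (if x < a then Max {p \<in> P. p \<le> x} else Min {p \<in> P. x \<le> p})"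

text \<open>The next point of \<open>P\<close> towards \<open>a\<close>, which lies across
  \<open>a\<close> when \<open>p\<close> is \<open>l\<close> or \<open>r\<close>. Either way
  \<open>p\<close> and \<open>inner p\<close> bound a gap of \<open>P\<close>, on which
  \<open>f\<close> is affine.\<close>

definition inner :: "real \<Rightarrow> real" where
  "inner p = (if p < a then Min {z \<in> P. p < z} else Max {z \<in> P. z < p})"

lemma nbr:
  assumes "x \<in> {Min P..Max P}" "x \<noteq> a"
  shows nbr_mem: "nbr x \<in> P" and outward_nbr: "outward (nbr x) x"
    and nbr_greatest: "\<And>p. p \<in> P \<Longrightarrow> outward p x \<Longrightarrow> outward p (nbr x)"
proof -
  have m: "Min P \<in> P" "Max P \<in> P" using finite_P P_nonempty by auto
  have "nbr x \<in> P \<and> outward (nbr x) x \<and> (\<forall>p\<in>P. outward p x \<longrightarrow> outward p (nbr x))"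
  proof (cases "x < a")
    case True
    let ?L = "{p \<in> P. p \<le> x}"
    have "finite ?L" "Min P \<in> ?L" using finite_P m assms by auto
    then have "Max ?L \<in> ?L" "\<And>p. p \<in> ?L \<Longrightarrow> p \<le> Max ?L"
      by (metis Max_in empty_iff) (simp add: \<open>finite ?L\<close>)
    then show ?thesis using True by (auto simp: nbr_def outward_def)
  next
    case False
    let ?R = "{p \<in> P. x \<le> p}"
    have "finite ?R" "Max P \<in> ?R" using finite_P m assms by auto
    then have "Min ?R \<in> ?R" "\<And>p. p \<in> ?R \<Longrightarrow> Min ?R \<le> p"
      by (metis Min_in empty_iff) (simp add: \<open>finite ?R\<close>)
    then show ?thesis using False assms by (auto simp: nbr_def outward_def)
  qed
  then show "nbr x \<in> P" "outward (nbr x) x" "\<And>p. p \<in> P \<Longrightarrow> outward p x \<Longrightarrow> outward p (nbr x)"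
    by auto
qed

lemma inner:
  assumes p: "p \<in> P"
  shows "inner p \<in> P"
    and "p < a \<Longrightarrow> p < inner p \<and> P \<inter> {p<..<inner p} = {}"
    and "a < p \<Longrightarrow> inner p < p \<and> P \<inter> {inner p<..<p} = {}"
proof -
  have "inner p \<in> P \<and> p < inner p \<and> P \<inter> {p<..<inner p} = {}" if "p < a"
  proof -
    let ?R = "{z \<in> P. p < z}"
    have R: "finite ?R" "r \<in> ?R" using finite_P r that by auto
    then have "Min ?R \<in> ?R" by (metis Min_in empty_iff)
    moreover have "P \<inter> {p<..<Min ?R} = {}" using Min_le[OF R(1)] by force
    ultimately show ?thesis using that by (simp add: inner_def)
  qed
  moreover have "inner p \<in> P \<and> inner p < p \<and> P \<inter> {inner p<..<p} = {}" if "a < p"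
  proof -
    let ?L = "{z \<in> P. z < p}"
    have L: "finite ?L" "l \<in> ?L" using finite_P l that by auto
    then have "Max ?L \<in> ?L" by (metis Max_in empty_iff)
    moreover have "P \<inter> {Max ?L<..<p} = {}" using Max_ge[OF L(1)] by force
    ultimately show ?thesis using that by (simp add: inner_def)
  qed
  ultimately show "inner p \<in> P" "p < a \<Longrightarrow> p < inner p \<and> P \<inter> {p<..<inner p} = {}"
    "a < p \<Longrightarrow> inner p < p \<and> P \<inter> {inner p<..<p} = {}"
    using P_ne_a[OF p] by (auto simp: neq_iff)
qed

lemma before_inner:
  assumes x: "x \<in> {Min P..Max P}" "x \<noteq> a"
  shows "x < a \<Longrightarrow> nbr x \<le> x \<and> x < inner (nbr x)"
    and "a < x \<Longrightarrow> x \<le> nbr x \<and> inner (nbr x) < x"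
proof -
  have out: "outward (nbr x) x" and mem: "inner (nbr x) \<in> P"
    using outward_nbr[OF x] inner(1)[OF nbr_mem[OF x]] .
  show "nbr x \<le> x \<and> x < inner (nbr x)" if "x < a"
  proof (intro conjI)
    show "nbr x \<le> x" using out that by (auto simp: outward_def)
    then have "nbr x < inner (nbr x)" using inner(2)[OF nbr_mem[OF x]] that by simp
    moreover have "inner (nbr x) \<le> nbr x" if "inner (nbr x) \<le> x"
      using nbr_greatest[OF x mem] that \<open>x < a\<close> \<open>nbr x \<le> x\<close> by (auto simp: outward_def)
    ultimately show "x < inner (nbr x)" by force
  qed
  show "x \<le> nbr x \<and> inner (nbr x) < x" if "a < x"
  proof (intro conjI)
    show "x \<le> nbr x" using out that by (auto simp: outward_def)
    then have "inner (nbr x) < nbr x" using inner(3)[OF nbr_mem[OF x]] that by simp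
    moreover have "nbr x \<le> inner (nbr x)" if "x \<le> inner (nbr x)"
      using nbr_greatest[OF x mem] that \<open>a < x\<close> \<open>x \<le> nbr x\<close> by (auto simp: outward_def)
    ultimately show "inner (nbr x) < x" by force
  qed
qed

definition slope :: "real \<Rightarrow> real" where
  "slope p = (f (inner p) - f p) / (inner p - p)"

text \<open>The deviation from the outward neighbour is multiplied by a factor that depends on the
  neighbour alone; \<open>inj_nbr\<close> rests on this.\<close>

lemma f_eq_slope:
  assumes x: "x \<in> {Min P..Max P}" "x \<noteq> a"
  shows "f x = f (nbr x) + slope (nbr x) * (x - nbr x)"
proof -
  note mem = nbr_mem[OF x] inner(1)[OF nbr_mem[OF x]]
  show ?thesis
  proof (cases "x < a")
    case True
    then have b: "nbr x \<le> x" "x < inner (nbr x)" using before_inner[OF x] by auto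
    then have "P \<inter> {nbr x<..<inner (nbr x)} = {}" using inner(2)[OF mem(1)] True by simp
    from affine[OF mem _ this, of x] b show ?thesis by (simp add: slope_def)
  next
    case False
    then have b: "x \<le> nbr x" "inner (nbr x) < x" using before_inner[OF x] x by auto
    then have "P \<inter> {inner (nbr x)<..<nbr x} = {}" using inner(3)[OF mem(1)] False x by simp
    from affine[OF mem(2,1) _ this, of x] b show ?thesis
      by (simp add: slope_def divide_simps) (simp add: algebra_simps)
  qed
qed

lemma f_between:
  assumes x: "x \<in> {Min P..Max P}" "x \<noteq> a"
  shows "min (f (nbr x)) (f (inner (nbr x))) \<le> f x" "f x \<le> max (f (nbr x)) (f (inner (nbr x)))"
proof -
  note mem = nbr_mem[OF x] inner(1)[OF nbr_mem[OF x]]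
  have "min (f (nbr x)) (f (inner (nbr x))) \<le> f x \<and> f x \<le> max (f (nbr x)) (f (inner (nbr x)))"
  proof (cases "x < a")
    case True
    then have b: "nbr x \<le> x" "x < inner (nbr x)" using before_inner[OF x] by auto
    then have "P \<inter> {nbr x<..<inner (nbr x)} = {}" using inner(2)[OF mem(1)] True by simp
    from affine[OF mem _ this, of x] affine_between[of "nbr x" "inner (nbr x)" x "f (nbr x)" "f (inner (nbr x))"] b
    show ?thesis by simp
  next
    case False
    then have b: "x \<le> nbr x" "inner (nbr x) < x" using before_inner[OF x] x by auto
    then have "P \<inter> {inner (nbr x)<..<nbr x} = {}" using inner(3)[OF mem(1)] False x by simp
    from affine[OF mem(2,1) _ this, of x] affine_between[of "inner (nbr x)" "nbr x" x "f (inner (nbr x))" "f (nbr x)"] b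
    show ?thesis by (simp add: min.commute max.commute)
  qed
  then show "min (f (nbr x)) (f (inner (nbr x))) \<le> f x" "f x \<le> max (f (nbr x)) (f (inner (nbr x)))"
    by auto
qed

text \<open>The gap of \<open>x\<close> is the one around \<open>a\<close>. There \<open>f\<close>
  is linear about \<open>a\<close> with a negative factor, so it swaps the sides and keeps the order
  of distances.\<close>

lemma outward_image_middle:
  assumes x: "x \<in> {Min P..Max P}" "x \<noteq> a" and other: "(inner (nbr x) < a) \<noteq> (x < a)"
  shows "outward (f (nbr x)) (f x)"
proof -
  obtain s where s: "s < 0" "\<And>z. z \<in> {l..r} \<Longrightarrow> f z = a + s * (z - a)" using middle by blast
  note mem = nbr_mem[OF x] inner(1)[OF nbr_mem[OF x]]
  have "nbr x \<in> {l..r}"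
  proof (cases "x < a")
    case True
    then have b: "nbr x \<le> x" "x < inner (nbr x)" using before_inner[OF x] by auto
    then have "P \<inter> {nbr x<..<inner (nbr x)} = {}" using inner(2)[OF mem(1)] True by simp
    moreover have "r \<le> inner (nbr x)" using other True P_gap[OF mem(2)] l by auto
    ultimately have "\<not> nbr x < l" using l r by force
    then show ?thesis using b True r by simp
  next
    case False
    then have b: "x \<le> nbr x" "inner (nbr x) < x" using before_inner[OF x] x by auto
    then have "P \<inter> {inner (nbr x)<..<nbr x} = {}" using inner(3)[OF mem(1)] False x by simp
    moreover have "inner (nbr x) \<le> l" using other False P_gap[OF mem(2)] r by auto
    ultimately have "\<not> r < nbr x" using l r by force
    then show ?thesis using b False x l by simp
  qed
  moreover have "x \<in> {l..r}"
    using calculation outward_nbr[OF x] l r by (auto simp: outward_def)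
  ultimately have fx: "f x - a = s * (x - a)" "f (nbr x) - f x = s * (nbr x - x)"
    using s(2)[of x] s(2)[of "nbr x"] by (simp_all add: algebra_simps)
  show ?thesis
  proof (cases "x < a")
    case True
    then have "0 < s * (x - a)" "0 \<le> s * (nbr x - x)"
      using s(1) outward_nbr[OF x] by (auto simp: outward_def intro: mult_neg_neg mult_nonpos_nonpos)
    then show ?thesis unfolding outward_def using fx by linarith
  next
    case False
    then have "s * (x - a) < 0" "s * (nbr x - x) \<le> 0"
      using s(1) outward_nbr[OF x] x by (auto simp: outward_def intro: mult_neg_pos mult_nonpos_nonneg)
    then show ?thesis unfolding outward_def using fx by linarith
  qed
qed

text \<open>The value \<open>f x\<close> lies between the images of the two ends of the gap of
  \<open>x\<close>, so one of these images is outward of it. If that of \<open>nbr x\<close> is not,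
  the inner end serves: by \<open>outward_image_middle\<close> it is on the side of
  \<open>x\<close>, and being closer to \<open>a\<close> it has smaller code.\<close>

lemma dominating_point:
  assumes x: "x \<in> {Min P..Max P}" "x \<noteq> a" and fx: "f x \<noteq> a"
  obtains e where "e \<in> P" "(e < a) = (x < a)" "outward (f e) (f x)" "e = nbr x \<or> code e < code (nbr x)"
proof (cases "outward (f (nbr x)) (f x)")
  case True
  then show thesis using that[of "nbr x"] nbr_mem[OF x] outward_same_side[OF outward_nbr[OF x]] by simp
next
  case False
  let ?n = "nbr x"
  let ?e = "inner ?n"
  have mem: "?n \<in> P" "?e \<in> P" using nbr_mem[OF x] inner(1)[OF nbr_mem[OF x]] .
  have side: "(?e < a) = (x < a)" using outward_image_middle[OF x] False by blast
  have "outward (f ?e) (f x)"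
    using f_between[OF x] False fx by (auto simp: outward_def min_def max_def split: if_splits)
  moreover have "outward ?n ?e" "?n \<noteq> ?e"
    using before_inner[OF x] side x P_ne_a[OF mem(2)] by (auto simp: outward_def neq_iff)
  ultimately show thesis using that[of ?e] mem side code_less[of ?n ?e] by simp
qed

section \<open>Cycles with the same over-rotation number\<close>

context
  fixes Q
  assumes Q: "Q \<subseteq> {Min P..Max P}" "is_cycle f Q" "2 \<le> card Q" and rho_Q: "rho f Q = rho f P"
begin

lemma Q_mem: "x \<in> Q \<Longrightarrow> x \<in> {Min P..Max P}" "x \<in> Q \<Longrightarrow> x \<noteq> a" "x \<in> Q \<Longrightarrow> f x \<in> Q"
  using Q cycle_ne_a[OF Q(2,3)] by (auto simp: is_cycle_def)

text \<open>Along the orbit the code of the outward neighbour changes by at most \<open>crossing x / 2 - rho f P\<close>;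
  these bounds add up to zero over \<open>Q\<close>, so each of them is attained.\<close>
lemma nbr_f:
  assumes "x \<in> Q"
  shows "nbr (f x) = f (nbr x)"
proof -
  define d where "d y = code (nbr y) + real (crossing y) / 2 - rho f P - code (nbr (f y))" for y
  \<comment> \<open>With \<open>e\<close> dominating \<open>y\<close>,
    \<open>code (nbr (f y))\<close> is at most \<open>code (f e)\<close>, and \<open>code e\<close>
    is at most \<open>code (nbr y)\<close>. Zero slack makes both equalities, hence
    \<open>e = nbr y\<close> and \<open>nbr (f y) = f e\<close>.\<close>
  have d: "0 \<le> d y \<and> (d y = 0 \<longrightarrow> nbr (f y) = f (nbr y))" if y: "y \<in> Q" for y
  proof -
    note yI = Q_mem(1,2)[OF y] and fy = Q_mem(1,2)[OF Q_mem(3)[OF y]]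
    obtain e where e: "e \<in> P" "(e < a) = (y < a)" "outward (f e) (f y)"
        "e = nbr y \<or> code e < code (nbr y)"
      using dominating_point[OF yI fy(2)] by metis
    have "outward (f e) (nbr (f y))"
      using nbr_greatest[OF fy f_mem[OF e(1)] e(3)] .
    then have "nbr (f y) = f e \<or> code (nbr (f y)) < code (f e)"
      using code_less[OF f_mem[OF e(1)] nbr_mem[OF fy]] by metis
    moreover have "crossing e = crossing y"
      using e(2) outward_same_side[OF e(3)] by (simp add: crossing_def)
    ultimately show ?thesis
      using e(4) code_step[OF e(1)] unfolding d_def by auto
  qed
  have "(\<Sum>y\<in>Q. d y) = (\<Sum>y\<in>Q. code (nbr y)) + (real (\<Sum>y\<in>Q. crossing y) / 2 - card Q * rho f P)
      - (\<Sum>y\<in>Q. code (nbr (f y)))"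
    by (simp add: d_def sum.distrib sum_subtractf sum_divide_distrib)
  also have "(\<Sum>y\<in>Q. code (nbr (f y))) = (\<Sum>y\<in>Q. code (nbr y))"
    using sum.reindex_bij_betw[OF is_cycle_bij[OF Q(2)], of "\<lambda>y. code (nbr y)"] .
  also have "real (\<Sum>y\<in>Q. crossing y) / 2 - card Q * rho f P = 0"
    using crossings_eq_orp(2)[OF Q] Q(3) unfolding rho_Q by (simp add: field_simps flip: of_nat_sum)
  finally have "(\<Sum>y\<in>Q. d y) = 0" by simp
  then have "d x = 0"
    using sum_nonneg_eq_0_iff[of Q d] d Q assms by (auto simp: is_cycle_def)
  then show ?thesis using d assms by blast
qed

lemma nbr_funpow:
  assumes "x \<in> Q"
  shows "nbr ((f ^^ n) x) = (f ^^ n) (nbr x)"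
  by (induction n) (auto simp: nbr_f is_cycle_funpow_closed[OF Q(2) assms])

lemma inj_nbr: "inj_on nbr Q"
proof (rule inj_onI)
  fix x x' assume x: "x \<in> Q" "x' \<in> Q" and eq: "nbr x = nbr x'"
  \<comment> \<open>The factor gained in \<open>n\<close> steps is the same for all points of the
    fibre, since \<open>nbr\<close> commutes with \<open>f\<close>.\<close>
  define s where "s n = (\<Prod>i<n. slope ((f ^^ i) (nbr x)))" for n
  have dist: "(f ^^ n) y - nbr ((f ^^ n) y) = s n * (y - nbr y)" if "y \<in> Q" "nbr y = nbr x" for n y
  proof (induction n)
    case (Suc n)
    let ?z = "(f ^^ n) y"
    have z: "?z \<in> Q" using is_cycle_funpow_closed[OF Q(2) that(1)] .
    have "f ?z - nbr (f ?z) = slope (nbr ?z) * (?z - nbr ?z)"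
      using f_eq_slope[OF Q_mem(1,2)[OF z]] nbr_f[OF z] by simp
    then show ?case using Suc nbr_funpow[OF that(1), of n] that(2) by (simp add: s_def)
  qed (simp add: s_def)
  obtain m where m: "(f ^^ m) x = x'" using Q(2) x unfolding is_cycle_def by metis
  let ?c = "s m" and ?d = "x - nbr x"
  have x': "x' - nbr x' = ?c * ?d" using dist[OF x(1) refl, of m] m by simp
  \<comment> \<open>The \<open>m\<close>-th iterate takes the fibre of \<open>x\<close> back to
    itself, scaling deviations by \<open>?c\<close> each time; after \<open>card Q\<close> rounds
    the orbit of \<open>x\<close> closes, so \<open>?c ^ card Q = 1\<close>.\<close>
  have iter: "(f ^^ (k * m)) x \<in> Q \<and> nbr ((f ^^ (k * m)) x) = nbr x
      \<and> (f ^^ (k * m)) x - nbr x = ?c ^ k * ?d" for k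
  proof (induction k)
    case (Suc k)
    let ?y = "(f ^^ (k * m)) x"
    have y: "?y \<in> Q" "nbr ?y = nbr x" using Suc by auto
    have "(f ^^ (Suc k * m)) x = (f ^^ m) ?y" by (simp add: funpow_add)
    moreover have "nbr ((f ^^ m) ?y) = nbr x"
      using nbr_funpow[OF y(1), of m] nbr_funpow[OF x(1), of m] y(2) m eq by simp
    ultimately show ?case
      using dist[OF y, of m] Suc is_cycle_funpow_closed[OF Q(2) y(1), of m] by simp
  qed (use x in simp)
  show "x = x'"
  proof (cases "?d = 0")
    case True
    then show ?thesis using x' eq by simp
  next
    case False
    have "(f ^^ (card Q * m)) x = x"
      using funpow_mod_eq[OF is_cycle_orbit(1)[OF Q(2) x(1)], of "card Q * m"] by simp
    then have "?c ^ card Q = 1" using iter[of "card Q"] False by simp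
    \<comment> \<open>Both points lie on the inward side of their common neighbour, so their
      deviations do not have opposite signs.\<close>
    moreover have "0 \<le> ?c"
    proof -
      have "0 \<le> (x' - nbr x') * ?d"
        using outward_nbr[OF Q_mem(1,2)[OF x(1)]] outward_nbr[OF Q_mem(1,2)[OF x(2)]] eq
        by (auto simp: outward_def mult_nonneg_nonneg mult_nonpos_nonpos)
      then have "0 \<le> ?c * (?d * ?d)" unfolding x' by (simp add: mult.assoc)
      moreover have "0 < ?d * ?d" using False by (auto simp: zero_less_mult_iff)
      ultimately show ?thesis by (simp add: zero_le_mult_iff not_less)
    qed
    ultimately have "?c = 1"
      using power_eq_iff_eq_base[of "card Q" ?c 1] Q(3) by simp
    then show ?thesis using x' eq by simp
  qed
qed

text \<open>Weak monotonicity comes from \<open>nbr_greatest\<close> on one side of \<open>a\<close>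
  and from side preservation across it; injectivity makes it strict.\<close>

lemma mono_nbr: "strict_mono_on Q nbr"
proof (rule strict_mono_onI)
  fix x y assume xy: "x \<in> Q" "y \<in> Q" "x < y"
  note xQ = Q_mem(1,2)[OF xy(1)] and yQ = Q_mem(1,2)[OF xy(2)]
  have "nbr x \<le> nbr y"
  proof (cases "(x < a) = (y < a)")
    case True
    then show ?thesis
      using outward_nbr[OF xQ] outward_nbr[OF yQ] xy(3)
        nbr_greatest[OF yQ nbr_mem[OF xQ]] nbr_greatest[OF xQ nbr_mem[OF yQ]]
      by (cases "x < a") (auto simp: outward_def)
  next
    case False
    then show ?thesis
      using outward_nbr[OF xQ] outward_nbr[OF yQ] xy(3) by (auto simp: outward_def)
  qed
  moreover have "nbr x \<noteq> nbr y" using inj_nbr xy by (auto dest: inj_onD)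
  ultimately show "nbr x < nbr y" by simp
qed

lemma pattern_of_eq: "pattern_of f Q = pattern_of f P"
proof -
  \<comment> \<open>The image contains a whole orbit in \<open>P\<close>, because \<open>nbr\<close>
    commutes with \<open>f\<close>.\<close>
  have "nbr ` Q = P"
  proof (rule equalityI)
    show "nbr ` Q \<subseteq> P" using nbr_mem Q_mem by blast
    show "P \<subseteq> nbr ` Q"
    proof
      fix p assume p: "p \<in> P"
      obtain x where x: "x \<in> Q" using Q(2) by (auto simp: is_cycle_def)
      then have "nbr x \<in> P" using nbr_mem Q_mem by blast
      then obtain n where "(f ^^ n) (nbr x) = p" using cyc p unfolding is_cycle_def by metis
      then have "nbr ((f ^^ n) x) = p" using nbr_funpow[OF x] by simp
      then show "p \<in> nbr ` Q" using is_cycle_funpow_closed[OF Q(2) x] by blast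
    qed
  qed
  moreover have "finite Q" "f ` Q \<subseteq> Q" using Q(2) by (auto simp: is_cycle_def)
  ultimately show ?thesis
    using pattern_of_conjugate[OF _ mono_nbr, of f f] nbr_f by simp
qed

end

end

section \<open>The fixed point and displacements of the \<open>P\<close>-linear map\<close>

lemma convergent_cycle_minimal_cycle:
  fixes g :: "real \<Rightarrow> real" and P :: "real set"
  defines "f \<equiv> P_linear g P"
  assumes cyc: "is_cycle g P" "2 \<le> card P" and conv: "convergent_cycle g P"
    and min_rho: "\<And>Q. Q \<subseteq> {Min P..Max P} \<Longrightarrow> is_cycle f Q \<Longrightarrow> 2 \<le> card Q \<Longrightarrow> rho g P \<le> rho f Q"
    and cop: "coprime (fst (orp g P)) (snd (orp g P))"
  shows "\<exists>l a r. minimal_cycle f P l a r"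
proof -
  have fin: "finite P" "P \<noteq> {}" and gP: "g ` P \<subseteq> P" using cyc by (auto simp: is_cycle_def)
  have f_eq: "f p = g p" if "p \<in> P" for p using P_linear_mem[OF fin(1) that] by (simp add: f_def)
  have affine: "f x = f p + (f p' - f p) * (x - p) / (p' - p)"
    if "p \<in> P" "p' \<in> P" "p < p'" "P \<inter> {p<..<p'} = {}" "x \<in> {p..p'}" for p p' x
    using P_linear_affine[OF fin(1) that] that f_eq by (simp add: f_def)
  have ne: "g p \<noteq> p" if "p \<in> P" for p using is_cycle_no_fixpoint[OF cyc that] .
  \<comment> \<open>Convergence places every point that moves right before every point that moves
    left, so the displacement changes sign only in the gap between \<open>l\<close> and
    \<open>r\<close>.\<close>
  define L R where "L = {p \<in> P. p < g p}" "R = {p \<in> P. g p < p}"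
  have m: "Min P \<in> P" "Max P \<in> P" using fin by auto
  have "g (Min P) \<in> P" "g (Max P) \<in> P" using m gP by auto
  then have "Min P \<le> g (Min P)" "g (Max P) \<le> Max P" using fin by auto
  then have "Min P \<in> L" "Max P \<in> R" 
    using m ne[OF m(1)] ne[OF m(2)] by (auto simp: L_R_def)
  then have "L \<noteq> {}" "R \<noteq> {}" by auto
  have "finite L" "finite R" using fin by (auto simp: L_R_def)
  define l r where "l = Max L" "r = Min R"
  have lr: "l \<in> L" "r \<in> R" unfolding l_r_def using \<open>finite L\<close> \<open>finite R\<close> \<open>L \<noteq> {}\<close> \<open>R \<noteq> {}\<close> by auto
  have L_R: "p < q" if "p \<in> L" "q \<in> R" for p q
    using that conv by (force simp: L_R_def convergent_cycle_def not_less le_less)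
  have P_LR: "p \<in> L \<and> p \<le> l \<or> p \<in> R \<and> r \<le> p" if "p \<in> P" for p
    unfolding l_r_def using that ne[OF that] \<open>finite L\<close> \<open>finite R\<close> by (auto simp: L_R_def neq_iff)
  have "l < r" using L_R lr by blast
  have gap: "P \<inter> {l<..<r} = {}" using P_LR by force
  define s where "s = (f r - f l) / (r - l)"
  have l: "l \<in> P" "l < f l" and r: "r \<in> P" "f r < r" using lr f_eq by (auto simp: L_R_def)
  have mid: "f x = f l + s * (x - l)" if "x \<in> {l..r}" for x
    using affine[OF l(1) r(1) \<open>l < r\<close> gap that] by (simp add: s_def)
  have "f r = f l + s * (r - l)" using mid[of r] \<open>l < r\<close> by simp
  then have "(s - 1) * (r - l) < 0" using l r by (simp add: algebra_simps)
  then have "s < 1" using \<open>l < r\<close> by (simp add: mult_less_0_iff)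
  \<comment> \<open>The fixed point of the affine piece on \<open>{l..r}\<close>. Its slope
    \<open>s\<close> is below 1 because the displacement is positive at \<open>l\<close> and
    negative at \<open>r\<close>.\<close>
  define a where "a = l + (f l - l) / (1 - s)"
  have a_eq: "(1 - s) * (a - l) = f l - l" using \<open>s < 1\<close> by (simp add: a_def)
  have mid': "f x - x = (1 - s) * (a - x)" if "x \<in> {l..r}" for x
    using mid[OF that] a_eq by (simp add: algebra_simps)
  have "0 < (1 - s) * (a - l)" "(1 - s) * (a - r) < 0"
    using mid'[of l] mid'[of r] l r \<open>l < r\<close> by auto
  then have a: "l < a" "a < r" using \<open>s < 1\<close> by (auto simp: zero_less_mult_iff mult_less_0_iff)
  have "f a = a" using mid'[of a] a by simp
  have dir: "(x < a \<longrightarrow> x < f x) \<and> (a < x \<longrightarrow> f x < x)" if x: "x \<in> {Min P..Max P}" for x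
  proof (cases "x \<in> {l..r}")
    case True
    then show ?thesis using mid'[of x] \<open>s < 1\<close>
      by (metis diff_gt_0_iff_gt diff_less_0_iff_less mult_less_0_iff zero_less_mult_iff)
  next
    \<comment> \<open>The gap around \<open>x\<close> now has both ends in \<open>L\<close> or both
      in \<open>R\<close>. The displacement is affine on it as well, so it keeps the sign it has at
      the ends.\<close>
    case False
    have "Min P < Max P" using False x P_LR[OF m(1)] P_LR[OF m(2)] m fin l(1) r(1) \<open>l < r\<close>
      by (meson Max_ge Min_le less_le_trans le_less_trans)
    then obtain p p' where p: "p \<in> P" "p' \<in> P" "p < p'" "P \<inter> {p<..<p'} = {}" "x \<in> {p..p'}"
      using consecutive_around[OF fin x] by metis
    have "min (f p - p) (f p' - p') \<le> f x - x \<and> f x - x \<le> max (f p - p) (f p' - p')"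
    proof -
      have "f x - x = (f p - p) + ((f p' - p') - (f p - p)) * (x - p) / (p' - p)"
        using affine[OF p] p(3) by (simp add: field_simps)
      then show ?thesis using affine_between[OF p(3,5)] by metis
    qed
    moreover have "p' \<le> l \<or> r \<le> p"
      using P_LR[OF p(1)] P_LR[OF p(2)] False p l(1) r(1) by force
    ultimately show ?thesis
    proof (elim disjE)
      assume b: "min (f p - p) (f p' - p') \<le> f x - x \<and> f x - x \<le> max (f p - p) (f p' - p')"
      show ?thesis if "p' \<le> l"
      proof -
        have "p \<in> L" "p' \<in> L" using P_LR p that L_R lr \<open>l < r\<close> by force+
        then have "p < f p" "p' < f p'" using f_eq p by (auto simp: L_R_def)
        then show ?thesis using b p(5) that a by (auto simp: min_def split: if_splits)
      qed
      show ?thesis if "r \<le> p"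
      proof -
        have "p \<in> R" "p' \<in> R" using P_LR p that L_R lr \<open>l < r\<close> by force+
        then have "f p < p" "f p' < p'" using f_eq p by (auto simp: L_R_def)
        then show ?thesis using b p(5) that a by (auto simp: max_def split: if_splits)
      qed
    qed
  qed
  have cycf: "is_cycle f P" and rhof: "rho f P = rho g P" and orpf: "orp f P = orp g P"
  proof -
    have "(f ^^ n) p = (g ^^ n) p" if "p \<in> P" for n p
      using that is_cycle_funpow_closed[OF cyc(1) that] by (induction n) (auto simp: f_eq)
    then show "is_cycle f P" using cyc gP f_eq by (auto simp: is_cycle_def)
    have "sign_changes f P = sign_changes g P"
      unfolding sign_changes_def using f_eq gP by (intro arg_cong[of _ _ card] Collect_cong) force
    then show "rho f P = rho g P" "orp f P = orp g P" by (simp_all add: rho_def orp_def)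
  qed
  have "minimal_cycle f P l a r"
  proof unfold_locales
    show "x < f x" if "x \<in> {Min P..Max P}" "x < a" for x using dir that by blast
    show "f x < x" if "x \<in> {Min P..Max P}" "a < x" for x using dir that by blast
    show "rho f P \<le> rho f Q" if "Q \<subseteq> {Min P..Max P}" "is_cycle f Q" "2 \<le> card Q" for Q
      unfolding rhof by (rule min_rho[OF that])
    show "coprime (fst (orp f P)) (snd (orp f P))" unfolding orpf by (rule cop)
  qed (fact cycf l(1) r(1) a gap \<open>f a = a\<close> affine)+
  then show ?thesis by blast
qed

theorem theorem2p4:
  fixes g :: "real \<Rightarrow> real" and P :: "real set"
  assumes "is_cycle g P"
    and "convergent_cycle g P"
    and "orot_interval (P_linear g P) (Min P) (Max P) = {rho g P .. 1/2}"
    and "coprime (fst (orp g P)) (snd (orp g P))"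
  shows "over_twist (pattern_of g P)"
proof -
  let ?f = "P_linear g P"
  have fin: "finite P" "P \<noteq> {}" and gP: "g ` P \<subseteq> P"
    using assms(1) by (auto simp: is_cycle_def)
  \<comment> \<open>For a single fixed point the over-rotation interval is empty, as its hull
    carries no longer cycle, whereas \<open>{rho g P .. 1/2}\<close> would be
    \<open>{0 .. 1/2}\<close>.\<close>
  have "card P \<noteq> 1"
  proof
    assume "card P = 1"
    then obtain x where P: "P = {x}" by (auto simp: card_1_singleton_iff)
    then have "\<not> 2 \<le> card Q" if "Q \<subseteq> {Min P..Max P}" for Q
      using card_mono[of "{x}" Q] that by simp
    then have "orot_interval ?f (Min P) (Max P) = {}"
      unfolding orot_interval_def by auto
    moreover have "rho g P = 0"
      using assms(1) P by (simp add: rho_def orp_def sign_changes_def is_cycle_def cong: conj_cong)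
    ultimately show False using assms(3) by simp
  qed
  moreover have "card P \<noteq> 0" using fin by simp
  ultimately have card: "2 \<le> card P" by linarith
  have "rho g P \<le> rho ?f Q" if "Q \<subseteq> {Min P..Max P}" "is_cycle ?f Q" "2 \<le> card Q" for Q
  proof -
    have "rho ?f Q \<in> orot_interval ?f (Min P) (Max P)"
      unfolding orot_interval_def using that by (intro subsetD[OF closure_subset]) blast
    then show ?thesis using assms(3) by simp
  qed
  then obtain l a r where "minimal_cycle ?f P l a r"
    using convergent_cycle_minimal_cycle[OF assms(1) card assms(2) _ assms(4)] by blast
  then interpret minimal_cycle ?f P l a r .
  have f_eq: "?f p = g p" if "p \<in> P" for p using P_linear_mem[OF fin(1) that] .
  have pat: "pattern_of ?f P = pattern_of g P"
    using fin f_eq by (simp add: pattern_of_def)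
  have rho: "rho_pat (pattern_of g P) = rho ?f P"
    using rho_pat_pattern_of[of P ?f] fin cyc unfolding pat by (auto simp: is_cycle_def)
  have "\<theta> = pattern_of g P"
    if \<theta>: "length \<theta> \<ge> 2" "rho_pat \<theta> = rho_pat (pattern_of g P)" "forces (pattern_of g P) \<theta>" for \<theta>
  proof -
    \<comment> \<open>The \<open>P\<close>-linear map itself exhibits the pattern of
      \<open>P\<close>, so forcing produces the cycle \<open>Q\<close> of pattern
      \<open>\<theta>\<close> inside it, where \<open>pattern_of_eq\<close> applies.\<close>
    have "interval_map ?f (Min P) (Max P)"
      using Min_less_Max continuous_f f_maps by (simp add: interval_map_def)
    moreover have "has_cycle_of_pattern ?f (Min P) (Max P) (pattern_of g P)"
      using P_subset cyc pat by (auto simp: has_cycle_of_pattern_def)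
    ultimately obtain Q where Q: "Q \<subseteq> {Min P..Max P}" "is_cycle ?f Q" "pattern_of ?f Q = \<theta>"
      using \<theta>(3) unfolding forces_def has_cycle_of_pattern_def by metis
    have "2 \<le> card Q" using \<theta>(1) Q(3) by (auto simp: pattern_of_def)
    moreover have "rho ?f Q = rho ?f P"
      using rho_pat_pattern_of[of Q ?f] Q \<theta>(2) rho by (auto simp: is_cycle_def)
    ultimately show ?thesis using pattern_of_eq[OF Q(1,2)] Q(3) pat by simp
  qed
  moreover have "cyclic_pattern (pattern_of g P)"
    using assms(1) by (auto simp: cyclic_pattern_def)
  ultimately show ?thesis unfolding over_twist_def by blast
qed

end
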